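(* Let $\lambda$ be a real number with $\lambda>-1$, $\lambda\neq0$, and let $x$ be a real number (or an indeterminate). Then $\mathrm{Bel}_{0,\lambda}(x)=1$, and for every integer $n\ge1$, \[ \mathrm{Bel}_{n,\lambda}(x)=\sum_{k=1}^{n}\left(\sum_{j=1}^{k}\frac{(-1)^{k-j}\binom{k}{j}}{k!}\left(\frac{\log(1+\lambda)}{\lambda}\right)^{k}(j\mid\lambda)_{n}\right)x^{k}. \]
   Context: The degenerate Bell polynomials $\mathrm{Bel}_{n,\lambda}(x)$ are defined by \[ (1+\lambda)^{\frac{x}{\lambda}\left((1+\lambda t)^{1/\lambda}-1\right)}=\exp\!\Big(\tfrac{x}{\lambda}\log(1+\lambda)\big((1+\lambda t)^{1/\lambda}-1\big)\Big)=\sum_{n=0}^{\infty}\mathrm{Bel}_{n,\lambda}(x)\frac{t^{n}}{n!}, \] with $(1+\lambda t)^{1/\lambda}=\exp(\tfrac1\lambda\log(1+\lambda t))$. For a number $a$, $(a\mid\lambda)_0=1$ and $(a\mid\lambda)_n=a(a-\lambda)(a-2\lambda)\cdots(a-(n-1)\lambda)$ for $n\ge1$. *)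

theory Defs
  imports Complex_Main "HOL-Computational_Algebra.Computational_Algebra"
begin

definition gen_falling :: "real \<Rightarrow> real \<Rightarrow> nat \<Rightarrow> real" where
  "gen_falling a l n = (\<Prod>i<n. a - real i * l)"

text \<open>The defining identities are read as identities of formal power series in \<open>t\<close>. Here
  \<^term>\<open>fps_exp 1\<close> is \<open>exp t\<close> and \<^term>\<open>fps_ln 1\<close> is \<open>log (1 + t)\<close>, so
  the next series is \<open>(1 + l t)\<^sup>1\<^sup>/\<^sup>l = exp ((1 / l) log (1 + l t))\<close>.\<close>

definition degenerate_exp_fps :: "real \<Rightarrow> real fps" where
  "degenerate_exp_fps l =
     fps_exp 1 oo (fps_const (1 / l) * (fps_ln 1 oo (fps_const l * fps_X)))"

definition degenerate_bell_fps :: "real \<Rightarrow> real \<Rightarrow> real fps" where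
  "degenerate_bell_fps l x =
     fps_exp 1 oo (fps_const (x / l * ln (1 + l)) * (degenerate_exp_fps l - 1))"

definition degenerate_bell :: "nat \<Rightarrow> real \<Rightarrow> real \<Rightarrow> real" where
  "degenerate_bell n l x = fact n * fps_nth (degenerate_bell_fps l x) n"

text \<open>The same generating function with \<open>x\<close> an indeterminate, as a series over \<open>\<real>[x]\<close>.
  As \<^const>\<open>fps_exp\<close> and \<^const>\<open>fps_ln\<close> need coefficients in a field, the series
  \<open>exp t\<close> and \<open>(1 + l t)\<^sup>1\<^sup>/\<^sup>l\<close> are lifted coefficientwise from \<open>\<real>\<close> to \<open>\<real>[x]\<close>.\<close>

definition fps_lift_poly :: "real fps \<Rightarrow> real poly fps" where
  "fps_lift_poly F = Abs_fps (\<lambda>n. [:fps_nth F n:])"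

definition degenerate_bell_poly_fps :: "real \<Rightarrow> real poly fps" where
  "degenerate_bell_poly_fps l =
     fps_lift_poly (fps_exp 1) oo
       (fps_const (smult (1 / l * ln (1 + l)) [:0, 1:]) * (fps_lift_poly (degenerate_exp_fps l) - 1))"

definition degenerate_bell_poly :: "nat \<Rightarrow> real \<Rightarrow> real poly" where
  "degenerate_bell_poly n l = smult (fact n) (fps_nth (degenerate_bell_poly_fps l) n)"

lemma poly_fps_nth_power:
  fixes F :: "real poly fps" and G :: "real fps"
  assumes "\<And>n. poly (fps_nth F n) x = fps_nth G n"
  shows "poly (fps_nth (F ^ k) n) x = fps_nth (G ^ k) n"
  by (induction k arbitrary: n) (simp_all add: fps_mult_nth poly_sum assms)

lemma poly_degenerate_bell_poly: "poly (degenerate_bell_poly n l) x = degenerate_bell n l x"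
proof -
  let ?F = "fps_const (smult (1 / l * ln (1 + l)) [:0, 1:]) * (fps_lift_poly (degenerate_exp_fps l) - 1)"
  let ?G = "fps_const (x / l * ln (1 + l)) * (degenerate_exp_fps l - 1)"
  have coeff: "poly (fps_nth ?F m) x = fps_nth ?G m" for m
    by (cases "m = 0") (simp_all add: fps_lift_poly_def)
  have pow: "poly (fps_nth (?F ^ i) n) x = fps_nth (?G ^ i) n" for i
    by (rule poly_fps_nth_power) (rule coeff)
  have "poly (fps_nth (fps_lift_poly (fps_exp 1) oo ?F) n) x = fps_nth (fps_exp 1 oo ?G) n"
    unfolding fps_compose_nth poly_sum poly_mult pow by (simp add: fps_lift_poly_def)
  then show ?thesis
    unfolding degenerate_bell_poly_def degenerate_bell_def degenerate_bell_poly_fps_def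
      degenerate_bell_fps_def poly_smult by simp
qed

end

theory Submission
  imports Defs
begin

text \<open>Powers of \<open>E = (1 + l t)\<^sup>1\<^sup>/\<^sup>l\<close> satisfy \<open>(1 + l t) (E\<^sup>j)' = j E\<^sup>j\<close>. Comparing coefficients
  gives a first-order recurrence, so \<open>E\<^sup>j\<close> is the exponential generating function of
  \<open>(j | l)\<^sub>n\<close>. The Bell formula then comes from the exponential series in powers of \<open>E - 1\<close>
  and the binomial theorem for \<open>(E - 1)\<^sup>k\<close>; the terms with \<open>k = 0\<close> or \<open>j = 0\<close>
  only contribute to the constant coefficient.\<close>

lemma degenerate_exp_nth_0 [simp]: "fps_nth (degenerate_exp_fps l) 0 = 1"
  by (simp add: degenerate_exp_fps_def)

text \<open>The exponent \<open>(1 / l) log (1 + l t)\<close> has derivative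
  \<open>1 / (1 + l t)\<close>: the chain rule produces a factor \<open>l\<close> that cancels
  \<open>1 / l\<close>.\<close>

lemma degenerate_exp_deriv:
  assumes "l \<noteq> 0"
  shows "(1 + fps_const l * fps_X) * fps_deriv (degenerate_exp_fps l) = degenerate_exp_fps l"
proof -
  let ?u = "fps_const l * fps_X :: real fps"
  let ?L = "fps_const (1 / l) * (fps_ln 1 oo ?u)"
  have ln_deriv: "fps_deriv (fps_ln 1 oo ?u) = inverse (1 + ?u) * fps_const l"
    by (simp add: fps_compose_deriv fps_ln_deriv fps_inverse_compose fps_compose_add_distrib)
  have "(1 + ?u) * fps_deriv ?L = (1 + ?u) * inverse (1 + ?u) * (fps_const (1 / l) * fps_const l)"
    unfolding fps_deriv_mult_const_left ln_deriv by (simp only: ac_simps)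
  also have "\<dots> = 1"
    using assms by (simp add: inverse_mult_eq_1')
  finally have L_deriv: "(1 + ?u) * fps_deriv ?L = 1" .
  \<comment> \<open>Chain rule, valid since \<open>?L\<close> has zero constant term;
    \<open>fps_exp 1\<close> is its own derivative.\<close>
  have "fps_deriv (degenerate_exp_fps l) = degenerate_exp_fps l * fps_deriv ?L"
    unfolding degenerate_exp_fps_def by (subst fps_compose_deriv) simp_all
  then have "(1 + ?u) * fps_deriv (degenerate_exp_fps l)
      = degenerate_exp_fps l * ((1 + ?u) * fps_deriv ?L)"
    by (simp only: ac_simps)
  then show ?thesis
    by (simp only: L_deriv mult_1_right)
qed

lemma degenerate_exp_power_deriv:
  assumes "l \<noteq> 0"
  shows "(1 + fps_const l * fps_X) * fps_deriv (degenerate_exp_fps l ^ j)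
           = of_nat j * degenerate_exp_fps l ^ j"
\<comment> \<open>Writing \<open>j = Suc i\<close> turns the exponent \<open>j - 1\<close> of the
  power rule into \<open>i\<close>; for \<open>j = 0\<close> both sides vanish.\<close>
proof (cases j)
  case (Suc i)
  let ?E = "degenerate_exp_fps l"
  have "(1 + fps_const l * fps_X) * fps_deriv (?E ^ j)
      = of_nat j * ?E ^ i * ((1 + fps_const l * fps_X) * fps_deriv ?E)"
    using fps_deriv_power'[of ?E j] Suc
    by (simp only: diff_Suc_1 ac_simps)
  then show ?thesis
    unfolding degenerate_exp_deriv[OF assms] by (simp only: Suc power_Suc ac_simps)
qed simp

lemma degenerate_exp_power_nth:
  assumes "l \<noteq> 0"
  shows "fps_nth (degenerate_exp_fps l ^ j) n = gen_falling (real j) l n / fact n"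
proof (induction n)
  case 0
  show ?case by (simp add: gen_falling_def fps_nth_power_0)
next
  case (Suc n)
  let ?F = "degenerate_exp_fps l ^ j"
  have "fps_nth ((1 + fps_const l * fps_X) * fps_deriv ?F) n = fps_nth (of_nat j * ?F) n"
    by (simp only: degenerate_exp_power_deriv[OF assms])
  \<comment> \<open>Multiplication by \<open>fps_X\<close> shifts the derivative, so its coefficient
    at \<open>n\<close> is \<open>real n * fps_nth ?F n\<close>. For \<open>n = 0\<close> the factor
    \<open>real n\<close> gives the required zero.\<close>
  then have "real (Suc n) * fps_nth ?F (Suc n) + l * (real n * fps_nth ?F n) = real j * fps_nth ?F n"
    by (cases n) (simp_all add: distrib_right mult.assoc flip: fps_of_nat)
  then have "real (Suc n) * fps_nth ?F (Suc n) = (real j - real n * l) * fps_nth ?F n"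
    by (simp add: algebra_simps)
  then have "fps_nth ?F (Suc n) = (real j - real n * l) * fps_nth ?F n / real (Suc n)"
    by (simp add: field_simps del: of_nat_Suc)
  then show ?case
    by (simp add: Suc.IH gen_falling_def mult.commute)
qed

lemma degenerate_exp_minus_one_power_nth:
  assumes "l \<noteq> 0" and "n \<ge> 1"
  shows "fps_nth ((degenerate_exp_fps l - 1) ^ k) n
           = (\<Sum>j=1..k. (-1) ^ (k - j) * real (k choose j) * gen_falling (real j) l n) / fact n"
proof -
  let ?E = "degenerate_exp_fps l"
  have "(?E - 1) ^ k = (\<Sum>j\<le>k. fps_const ((-1) ^ (k - j) * real (k choose j)) * ?E ^ j)"
    using binomial_ring[of ?E "-1" k]
    by (simp add: ac_simps flip: fps_of_nat fps_const_mult fps_const_power fps_const_neg)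
  then have "fps_nth ((?E - 1) ^ k) n
      = (\<Sum>j\<le>k. (-1) ^ (k - j) * real (k choose j) * gen_falling (real j) l n) / fact n"
    by (simp add: fps_sum_nth degenerate_exp_power_nth[OF assms(1)] sum_divide_distrib)
  \<comment> \<open>The term \<open>j = 0\<close> drops out: for \<open>n \<ge> 1\<close> the
    product \<open>gen_falling 0 l n\<close> contains the factor \<open>0\<close> at
    \<open>i = 0\<close>.\<close>
  also have "(\<Sum>j\<le>k. (-1) ^ (k - j) * real (k choose j) * gen_falling (real j) l n)
      = (\<Sum>j=1..k. (-1) ^ (k - j) * real (k choose j) * gen_falling (real j) l n)"
    using assms(2)
    by (intro sum.mono_neutral_right) (auto simp: gen_falling_def Suc_le_eq)
  finally show ?thesis .
qed

lemma degenerate_bell_0: "degenerate_bell 0 l x = 1"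
  by (simp add: degenerate_bell_def degenerate_bell_fps_def)

lemma degenerate_bell_eq_sum:
  assumes "l \<noteq> 0" and "n \<ge> 1"
  shows "degenerate_bell n l x =
           (\<Sum>k=1..n. (\<Sum>j=1..k. (-1) ^ (k - j) * real (k choose j) / fact k *
              (ln (1 + l) / l) ^ k * gen_falling (real j) l n) * x ^ k)"
proof -
  let ?G = "degenerate_exp_fps l - 1"
  let ?c = "x / l * ln (1 + l)"
  have "degenerate_bell n l x = fact n * (\<Sum>k=0..n. ?c ^ k / fact k * fps_nth (?G ^ k) n)"
    by (simp add: degenerate_bell_def degenerate_bell_fps_def fps_compose_nth
        power_mult_distrib fps_const_power)
  \<comment> \<open>The term \<open>k = 0\<close> drops out because \<open>?G ^ 0 = 1\<close> has no
    coefficient in positive degree.\<close>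
  also have "(\<Sum>k=0..n. ?c ^ k / fact k * fps_nth (?G ^ k) n)
      = (\<Sum>k=1..n. ?c ^ k / fact k * fps_nth (?G ^ k) n)"
    using assms(2) by (intro sum.mono_neutral_right) (auto simp: Suc_le_eq)
  also have "fact n * \<dots> = (\<Sum>k=1..n. (\<Sum>j=1..k. (-1) ^ (k - j) * real (k choose j) / fact k *
              (ln (1 + l) / l) ^ k * gen_falling (real j) l n) * x ^ k)"
    unfolding sum_distrib_left
  proof (intro sum.cong refl)
    fix k
    have "?c ^ k = (ln (1 + l) / l) ^ k * x ^ k"
      by (simp add: power_mult_distrib power_divide)
    then show "fact n * (?c ^ k / fact k * fps_nth (?G ^ k) n)
        = (\<Sum>j=1..k. (-1) ^ (k - j) * real (k choose j) / fact k *
              (ln (1 + l) / l) ^ k * gen_falling (real j) l n) * x ^ k"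
      by (simp add: degenerate_exp_minus_one_power_nth[OF assms] sum_distrib_left
          sum_distrib_right sum_divide_distrib ac_simps)
  qed
  finally show ?thesis .
qed

theorem theorem10:
  fixes l :: real
  assumes "l > -1" and "l \<noteq> 0"
  shows "(\<forall>x::real. degenerate_bell 0 l x = 1 \<and>
           (\<forall>n\<ge>1. degenerate_bell n l x =
              (\<Sum>k=1..n. (\<Sum>j=1..k. (-1) ^ (k - j) * real (k choose j) / fact k *
                 (ln (1 + l) / l) ^ k * gen_falling (real j) l n) * x ^ k)))
       \<and> (degenerate_bell_poly 0 l = 1 \<and>
           (\<forall>n\<ge>1. degenerate_bell_poly n l =
              (\<Sum>k=1..n. smult (\<Sum>j=1..k. (-1) ^ (k - j) * real (k choose j) / fact k *
                 (ln (1 + l) / l) ^ k * gen_falling (real j) l n) ([:0, 1:] ^ k))))"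
proof (intro conjI allI impI)
  show "degenerate_bell 0 l x = 1" for x
    by (rule degenerate_bell_0)
  show "degenerate_bell n l x =
      (\<Sum>k=1..n. (\<Sum>j=1..k. (-1) ^ (k - j) * real (k choose j) / fact k *
         (ln (1 + l) / l) ^ k * gen_falling (real j) l n) * x ^ k)" if "n \<ge> 1" for n x
    by (rule degenerate_bell_eq_sum[OF assms(2) that])
  \<comment> \<open>A real polynomial is determined by its values, so both identities in the
    indeterminate follow from those at every real \<open>x\<close>.\<close>
  show "degenerate_bell_poly 0 l = 1"
    by (rule poly_ext) (simp add: poly_degenerate_bell_poly degenerate_bell_0)
  show "degenerate_bell_poly n l =
      (\<Sum>k=1..n. smult (\<Sum>j=1..k. (-1) ^ (k - j) * real (k choose j) / fact k *
         (ln (1 + l) / l) ^ k * gen_falling (real j) l n) ([:0, 1:] ^ k))" if "n \<ge> 1" for n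
    by (rule poly_ext)
      (simp add: poly_degenerate_bell_poly degenerate_bell_eq_sum[OF assms(2) that] poly_sum)
qed

end
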